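(* Let $D$ be a diagram in $[n]\times[n]$ such that there exist $1\le i_1<i_2\le n$ and $1\le j_1<j_2\le n$ with $(i_1,j_1),(i_1,j_2)\notin D$ and $(i_2,j_1),(i_2,j_2)\in D$. Then the family of polynomials $\big(\det(Y_D^C)\big)_{C\le D}$, indexed by all diagrams $C\le D$, is linearly dependent over $\mathbb{C}$.
   Context: Write $[n]=\{1,\dots,n\}$. A diagram is a subset $D\subseteq[n]\times[n]$; $(i,j)$ is the box in row $i$, column $j$. We identify $D$ with $(D_1,\dots,D_n)$, $i\in D_j$ iff $(i,j)\in D$. For $R=\{r_1<\dots<r_m\}$, $S=\{s_1<\dots<s_m\}\subseteq[n]$, $R\le S$ means $r_k\le s_k$ for all $k$; for diagrams, $C\le D$ means $|C_j|=|D_j|$ and $C_j\le D_j$ for all $j$. $Y$ is the upper-triangular $n\times n$ matrix with entries indeterminates $y_{ij}$ ($i\le j$) and $0$ below the diagonal; $Y^R_S$ is the submatrix of $Y$ with rows indexed by $R$ and columns indexed by $S$; $\det(Y_D^C)=\prod_{j=1}^n\det(Y^{C_j}_{D_j})$. These polynomials span the flagged Weyl module $\mathcal{M}_D$. *)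

theory Defs
  imports
    Complex_Main
    "HOL-Library.Poly_Mapping"
    "Jordan_Normal_Form.Determinant"
    "Jordan_Normal_Form.DL_Submatrix"
begin

text \<open>
  Polynomials over the complex numbers in indeterminates indexed by \<open>nat \<times> nat\<close>: finitely
  supported maps from monomials (exponent vectors) to coefficients, with the convolution product
  of \<^theory>\<open>HOL-Library.Poly_Mapping\<close>.
\<close>

type_synonym cpoly = "((nat \<times> nat) \<Rightarrow>\<^sub>0 nat) \<Rightarrow>\<^sub>0 complex"

definition indet :: "nat \<Rightarrow> nat \<Rightarrow> cpoly" where
  "indet i j = Poly_Mapping.single (Poly_Mapping.single (i, j) 1) 1"

definition scale :: "complex \<Rightarrow> cpoly \<Rightarrow> cpoly" where
  "scale c p = Poly_Mapping.single 0 c * p"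

text \<open>
  Dependence of an indexed family, so a polynomial attained at two different indices already makes
  the family dependent. This is why \<^const>\<open>module.dependent\<close>, a notion for sets, is not used.
\<close>

definition lin_dependent_family :: "('i \<Rightarrow> cpoly) \<Rightarrow> 'i set \<Rightarrow> bool" where
  "lin_dependent_family f I \<longleftrightarrow>
     (\<exists>J c. finite J \<and> J \<subseteq> I \<and> (\<exists>i\<in>J. c i \<noteq> 0) \<and> (\<Sum>i\<in>J. scale (c i) (f i)) = 0)"

definition diagram :: "nat \<Rightarrow> (nat \<times> nat) set \<Rightarrow> bool" where
  "diagram n D \<longleftrightarrow> D \<subseteq> {1..n} \<times> {1..n}"

definition column :: "(nat \<times> nat) set \<Rightarrow> nat \<Rightarrow> nat set" where
  "column D j = {i. (i, j) \<in> D}"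

text \<open>\<^term>\<open>pick R k\<close> is the \<open>k\<close>-th smallest element of \<open>R\<close>, counting from 0.\<close>

definition set_le :: "nat set \<Rightarrow> nat set \<Rightarrow> bool" where
  "set_le R S \<longleftrightarrow> card R = card S \<and> (\<forall>k < card R. pick R k \<le> pick S k)"

definition diagram_le :: "nat \<Rightarrow> (nat \<times> nat) set \<Rightarrow> (nat \<times> nat) set \<Rightarrow> bool" where
  "diagram_le n C D \<longleftrightarrow> (\<forall>j\<in>{1..n}. set_le (column C j) (column D j))"

text \<open>
  Diagrams and indeterminates are numbered from 1, whereas matrix positions are numbered from 0;
  hence the shifts in the next two definitions.
\<close>

definition Ymat :: "nat \<Rightarrow> cpoly mat" where
  "Ymat n = mat n n (\<lambda>(i, j). if i \<le> j then indet (i + 1) (j + 1) else 0)"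

definition Ysub :: "nat \<Rightarrow> nat set \<Rightarrow> nat set \<Rightarrow> cpoly mat" where
  "Ysub n R S = submatrix (Ymat n) ((\<lambda>i. i - 1) ` R) ((\<lambda>j. j - 1) ` S)"

definition det_poly :: "nat \<Rightarrow> (nat \<times> nat) set \<Rightarrow> (nat \<times> nat) set \<Rightarrow> cpoly" where
  "det_poly n D C = (\<Prod>j\<in>{1..n}. det (Ysub n (column C j) (column D j)))"

end

theory Submission
  imports Defs
begin

text \<open>
  Let \<open>A\<close> and \<open>B\<close> be the two columns, so \<open>i\<^sub>1 \<notin> A \<union> B\<close> and \<open>i\<^sub>2 \<in> A \<inter> B\<close>. In the product of the
  minors of \<open>Y\<close> with columns \<open>A\<close>, \<open>B\<close> and rows \<open>A\<close>, \<open>B - {i\<^sub>2} \<union> {i\<^sub>1}\<close>, fix the rows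
  \<open>P = A \<inter> B - {i\<^sub>2}\<close> of the first minor. The other rows of the two minors are exactly the elements
  of \<open>U = A \<union> B \<union> {i\<^sub>1}\<close>. Antisymmetrising over them gives zero, since \<open>U\<close> is larger than the set
  \<open>A \<union> B\<close> of available columns. Each term is up to sign a product \<open>det (Y\<^sup>R\<^sub>A) det (Y\<^sup>S\<^sub>B)\<close> or zero,
  and as \<open>Y\<close> is upper triangular only terms with \<open>R \<le> A\<close> and \<open>S \<le> B\<close> survive. The terms with
  \<open>(R, S) = (A, B - {i\<^sub>2} \<union> {i\<^sub>1})\<close> are all equal, so they do not cancel.
\<close>

section \<open>Sorted enumerations and the order on finite sets\<close>

lemma bij_betw_pick:
  assumes "finite S"
  shows "bij_betw (pick S) {0..<card S} S"
proof -
  have "inj_on (pick S) {0..<card S}"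
    by (rule inj_onI) (metis atLeastLessThan_iff linorder_neqE_nat less_irrefl pick_mono_le)
  moreover have "pick S ` {0..<card S} \<subseteq> S"
    using pick_in_set_le by auto
  ultimately show ?thesis
    using assms by (simp add: bij_betw_def card_image card_subset_eq)
qed

text \<open>A matching that need not be monotone is enough. If \<open>pick S k < pick R k\<close>,
  the \<open>k + 1\<close> elements of \<open>S\<close> up to \<open>pick S k\<close> have partners
  in \<open>R\<close> below \<open>pick R k\<close>, where only \<open>k\<close> elements
  lie.\<close>

lemma set_leI:
  assumes fin: "finite S" and f: "bij_betw f I R" and g: "bij_betw g I S"
    and le: "\<And>i. i \<in> I \<Longrightarrow> f i \<le> g i"
  shows "set_le R S"
  unfolding set_le_def
proof (intro conjI allI impI)
  have finI: "finite I" using bij_betw_finite[OF g] fin by simp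
  have finR: "finite R" using bij_betw_finite[OF f] finI by simp
  show card_eq: "card R = card S"
    using bij_betw_same_card[OF f] bij_betw_same_card[OF g] by simp
  fix k assume k: "k < card R"
  show "pick R k \<le> pick S k"
  proof (rule ccontr)
    assume "\<not> pick R k \<le> pick S k"
    then have lt: "pick S k < pick R k" by simp
    have S: "card {s\<in>S. s < pick S k} = k" "pick S k \<in> S"
      using card_pick_le pick_in_set_le k card_eq by metis+
    have "{s\<in>S. s \<le> pick S k} = insert (pick S k) {s\<in>S. s < pick S k}"
      using S(2) by auto
    then have "Suc k = card {s\<in>S. s \<le> pick S k}"
      using S fin by simp
    also have "{s\<in>S. s \<le> pick S k} = g ` {i\<in>I. g i \<le> pick S k}"
      using g by (auto simp: bij_betw_def)
    also have "card \<dots> \<le> card {i\<in>I. g i \<le> pick S k}"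
      using finI by (intro card_image_le) simp
    also have "\<dots> = card (f ` {i\<in>I. g i \<le> pick S k})"
      using f by (intro card_image[symmetric]) (auto simp: bij_betw_def inj_on_def)
    also have "\<dots> \<le> card {r\<in>R. r < pick R k}"
    proof (rule card_mono)
      show "f ` {i\<in>I. g i \<le> pick S k} \<subseteq> {r\<in>R. r < pick R k}"
        using f le lt by (fastforce simp: bij_betw_def)
    qed (use finR in simp)
    also have "\<dots> = k" using k by (rule card_pick_le)
    finally show False by simp
  qed
qed

lemma set_le_refl: "set_le S S"
  by (simp add: set_le_def)

section \<open>Minors with rows given by a function on the columns\<close>

text \<open>Row \<open>r a\<close> sits in the position of column \<open>a\<close>, so \<open>r\<close> fixes the sign of the minor.\<close>

definition minor :: "(nat \<Rightarrow> nat \<Rightarrow> 'a :: comm_ring_1) \<Rightarrow> nat set \<Rightarrow> (nat \<Rightarrow> nat) \<Rightarrow> 'a" where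
  "minor Y A r = det (mat (card A) (card A) (\<lambda>(i, j). Y (r (pick A i)) (pick A j)))"

lemma minor_cong:
  assumes "\<And>a. a \<in> A \<Longrightarrow> r a = s a"
  shows "minor Y A r = minor Y A s"
proof -
  have "mat (card A) (card A) (\<lambda>(i, j). Y (r (pick A i)) (pick A j)) =
        mat (card A) (card A) (\<lambda>(i, j). Y (s (pick A i)) (pick A j))"
    using assms pick_in_set_le by (intro eq_matI) auto
  then show ?thesis by (simp add: minor_def)
qed

text \<open>The Leibniz formula with factors indexed by the elements of \<open>A\<close> instead of
  matrix positions, so that the factors of two minors can be regrouped over one set.\<close>

lemma minor_expand:
  assumes "finite A"
  shows "minor Y A r = (\<Sum>p | p permutes {0..<card A}.
    signof p * (\<Prod>a\<in>A. Y (r a) (pick A (p (inv_into {0..<card A} (pick A) a)))))"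
  unfolding minor_def
proof (subst det_def'[where n = "card A"], simp, intro sum.cong refl)
  fix p assume "p \<in> {p. p permutes {0..<card A}}"
  then have p: "p permutes {0..<card A}" by simp
  let ?f = "pick A" and ?I = "{0..<card A}"
  let ?M = "mat (card A) (card A) (\<lambda>(i, j). Y (r (pick A i)) (pick A j))"
  have bij: "bij_betw ?f ?I A" using assms by (rule bij_betw_pick)
  have "(\<Prod>i\<in>?I. ?M $$ (i, p i)) = (\<Prod>i\<in>?I. Y (r (pick A i)) (pick A (p i)))"
    using permutes_in_image[OF p] by (intro prod.cong) auto
  also have "\<dots> = (\<Prod>i\<in>?I. (\<lambda>a. Y (r a) (pick A (p (inv_into ?I ?f a)))) (?f i))"
    using bij by (intro prod.cong) (auto simp: bij_betw_def)
  also have "\<dots> = (\<Prod>a\<in>A. Y (r a) (pick A (p (inv_into ?I ?f a))))"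
    using bij by (rule prod.reindex_bij_betw)
  finally show "signof p * (\<Prod>i = 0..<card A. ?M $$ (i, p i)) =
    signof p * (\<Prod>a\<in>A. Y (r a) (pick A (p (inv_into ?I ?f a))))" by simp
qed

lemma minor_eq_0_if_not_inj:
  assumes fin: "finite A" and "\<not> inj_on r A"
  shows "minor Y A r = 0"
proof -
  obtain a b where ab: "a \<in> A" "b \<in> A" "a \<noteq> b" "r a = r b"
    using assms(2) by (auto simp: inj_on_def)
  have "A = pick A ` {0..<card A}"
    using bij_betw_pick[OF fin] by (simp add: bij_betw_def)
  then have "a \<in> pick A ` {0..<card A}" "b \<in> pick A ` {0..<card A}"
    using ab(1,2) by simp_all
  then obtain i j where ij: "i < card A" "j < card A" "a = pick A i" "b = pick A j"
    by auto
  show ?thesis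
    unfolding minor_def
    by (rule det_identical_rows[where n = "card A" and i = i and j = j])
      (use ij ab in \<open>auto intro!: eq_vecI\<close>)
qed

text \<open>Transported along the enumeration of \<open>A\<close>, \<open>p\<close> becomes a
  permutation of the matrix rows with the same sign.\<close>

lemma minor_compose_permutation:
  assumes fin: "finite A" and p: "p permutes A"
  shows "minor Y A (r \<circ> p) = of_int (sign p) * minor Y A r"
proof -
  let ?I = "{0..<card A}"
  let ?g = "inv_into ?I (pick A)"
  let ?q = "map_permutation A ?g p"
  have bij: "bij_betw (pick A) ?I A" using fin by (rule bij_betw_pick)
  have bij': "bij_betw ?g A ?I" using bij by (rule bij_betw_inv_into)
  have q: "?q permutes ?I" using bij' p by (rule map_permutation_permutes)
  have sgn: "sign ?q = sign p"
    using bij' p fin by (intro sign_map_permutation) (auto simp: bij_betw_def)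
  have pick_q: "pick A (?q i) = p (pick A i)" if "i < card A" for i
  proof -
    have i: "i \<in> ?I" using that by simp
    have a: "pick A i \<in> A" using that by (rule pick_in_set_le)
    have "?q (?g (pick A i)) = ?g (p (pick A i))"
      using bij' a by (intro map_permutation_apply) (auto simp: bij_betw_def)
    moreover have "?g (pick A i) = i" using bij i by (rule bij_betw_inv_into_left)
    moreover have "pick A (?g (p (pick A i))) = p (pick A i)"
      using bij permutes_in_image[OF p] a by (intro bij_betw_inv_into_right) auto
    ultimately show ?thesis by simp
  qed
  let ?M = "mat (card A) (card A) (\<lambda>(i, j). Y (r (pick A i)) (pick A j))"
  have "mat (card A) (card A) (\<lambda>(i, j). Y ((r \<circ> p) (pick A i)) (pick A j)) =
        mat (card A) (card A) (\<lambda>(i, j). ?M $$ (?q i, j))"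
    using permutes_in_image[OF q] pick_q by (intro eq_matI) auto
  then have "minor Y A (r \<circ> p) = det (mat (card A) (card A) (\<lambda>(i, j). ?M $$ (?q i, j)))"
    by (simp add: minor_def)
  also have "\<dots> = signof ?q * det ?M"
    using q by (intro det_permute_rows) auto
  finally show ?thesis by (simp add: minor_def sgn)
qed

lemma minor_same_image:
  assumes fin: "finite A" and r: "inj_on r A" and s: "inj_on s A" and im: "r ` A = s ` A"
  shows "\<exists>d\<in>{1, -1 :: int}. minor Y A r = of_int d * minor Y A s"
proof -
  \<comment> \<open>The inverse of \<open>s\<close> after \<open>r\<close>, extended by the identity
    outside \<open>A\<close>; thus \<open>s \<circ> p\<close> agrees with \<open>r\<close> on
    \<open>A\<close>.\<close>
  define p where "p a = (if a \<in> A then inv_into A s (r a) else a)" for a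
  have sp: "s (p a) = r a" "p a \<in> A" if "a \<in> A" for a
  proof -
    have "r a \<in> s ` A" using that im by blast
    then show "s (p a) = r a" "p a \<in> A"
      using that by (simp_all add: p_def f_inv_into_f inv_into_into)
  qed
  have "inj_on p A"
    using sp r by (auto simp: inj_on_def) metis
  moreover have "p ` A \<subseteq> A" using sp by blast
  ultimately have "bij_betw p A A"
    using fin by (simp add: bij_betw_def endo_inj_surj)
  then have p: "p permutes A"
    by (rule bij_imp_permutes) (simp add: p_def)
  have "minor Y A r = minor Y A (s \<circ> p)"
    using sp by (intro minor_cong) simp
  also have "\<dots> = of_int (sign p) * minor Y A s"
    using fin p by (rule minor_compose_permutation)
  finally show ?thesis by (cases p rule: sign_cases) auto
qed

section \<open>Antisymmetrisation and the exchange relation\<close>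

text \<open>If \<open>k u = k v\<close>, composing \<open>p\<close> with the transposition of
  \<open>u\<close> and \<open>v\<close> keeps the product and flips the sign. The sum equals its
  negative, and \<open>tf\<close> rules out 2-torsion.\<close>

lemma sum_sign_prod_eq_0:
  fixes Y :: "'i \<Rightarrow> 'j \<Rightarrow> 'a :: comm_ring_1"
  assumes fin: "finite U" and ninj: "\<not> inj_on k U"
    and tf: "\<And>x :: 'a. x = - x \<Longrightarrow> x = 0"
  shows "(\<Sum>p | p permutes U. of_int (sign p) * (\<Prod>u\<in>U. Y (p u) (k u))) = 0"
proof (rule tf)
  obtain u v where uv: "u \<in> U" "v \<in> U" "u \<noteq> v" "k u = k v"
    using ninj by (auto simp: inj_on_def)
  let ?t = "Transposition.transpose u v"
  have t: "?t permutes U" using uv by (intro permutes_swap_id)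
  have kt: "k (?t x) = k x" for x
    using uv(4) by (simp add: Transposition.transpose_def)
  let ?h = "\<lambda>p. of_int (sign p) * (\<Prod>u\<in>U. Y (p u) (k u))"
  have "sum ?h {p. p permutes U} = (\<Sum>p | p permutes U. ?h (p \<circ> ?t))"
    by (rule sum_permutations_compose_right[OF t])
  also have "\<dots> = (\<Sum>p | p permutes U. - ?h p)"
  proof (intro sum.cong refl)
    fix p assume "p \<in> {p. p permutes U}"
    then have p: "p permutes U" by simp
    have "sign (p \<circ> ?t) = - sign p"
      using p t fin uv(3)
      by (subst sign_compose) (auto simp: sign_swap_id permutation_permutes)
    moreover have "(\<Prod>u\<in>U. Y ((p \<circ> ?t) u) (k u)) = (\<Prod>u\<in>U. (\<lambda>u. Y (p u) (k u)) (?t u))"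
      by (simp add: kt)
    moreover have "\<dots> = (\<Prod>u\<in>U. Y (p u) (k u))"
      using permutes_imp_bij[OF t] by (rule prod.reindex_bij_betw)
    ultimately show "?h (p \<circ> ?t) = - ?h p" by simp
  qed
  finally show "sum ?h {p. p permutes U} = - sum ?h {p. p permutes U}"
    by (simp add: sum_negf)
qed

text \<open>Expand both minors. For each fixed pair of column permutations, the factors over
  \<open>P\<close> do not depend on \<open>p\<close>, and the others form an antisymmetrised product
  over \<open>U\<close>, which vanishes because \<open>U\<close> has more elements than
  \<open>A \<union> B\<close>.\<close>

lemma garnir_relation:
  fixes Y :: "nat \<Rightarrow> nat \<Rightarrow> 'a :: comm_ring_1"
  assumes fin: "finite A" "finite B"
    and i: "i \<notin> A" "i \<notin> B" "i' \<in> A" "i' \<in> B"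
    and tf: "\<And>x :: 'a. x = - x \<Longrightarrow> x = 0"
  defines "P \<equiv> A \<inter> B - {i'}" and "U \<equiv> insert i (A \<union> B)"
    and "t \<equiv> Transposition.transpose i i'"
  shows "(\<Sum>p | p permutes U. of_int (sign p) *
    (minor Y A (\<lambda>a. if a \<in> P then a else p a) * minor Y B (p \<circ> t))) = 0"
proof -
  let ?f = "\<lambda>A q a. pick A (q (inv_into {0..<card A} (pick A) a))"
  let ?QA = "{q. q permutes {0..<card A}}" and ?QB = "{q. q permutes {0..<card B}}"
  have f_in: "?f A q a \<in> A" if "finite A" "q permutes {0..<card A}" "a \<in> A" for A q a
  proof -
    have "bij_betw (inv_into {0..<card A} (pick A)) A {0..<card A}"
      using bij_betw_pick[OF that(1)] by (rule bij_betw_inv_into)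
    then have "q (inv_into {0..<card A} (pick A) a) \<in> {0..<card A}"
      using that(3) by (simp only: permutes_in_image[OF that(2)] bij_betw_apply)
    then show ?thesis by (intro pick_in_set_le) simp
  qed
  have finU: "finite U" using fin by (simp add: U_def)
  have t_im: "t ` B = insert i (B - {i'})"
    using i by (auto simp: t_def Transposition.transpose_def image_iff)
  have t_bij: "bij_betw t B (insert i (B - {i'}))"
    unfolding t_im[symmetric] by (simp add: t_def bij_betw_def)
  have tt: "t (t x) = x" for x by (simp add: t_def)
  \<comment> \<open>The movable row slots of the two minors partition \<open>U\<close>: those of the
    first are \<open>A - P\<close>, and slot \<open>b\<close> of the second is labelled
    \<open>t b\<close>.\<close>
  have U_split: "U = (A - P) \<union> insert i (B - {i'})" "(A - P) \<inter> insert i (B - {i'}) = {}"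
    using i by (auto simp: U_def P_def)
  have term0: "(\<Sum>p | p permutes U. of_int (sign p) *
       ((\<Prod>a\<in>A. Y (if a \<in> P then a else p a) (?f A q a)) *
        (\<Prod>b\<in>B. Y ((p \<circ> t) b) (?f B q' b)))) = 0" (is "?L = 0")
    if q: "q permutes {0..<card A}" and q': "q' permutes {0..<card B}" for q q'
  proof -
    \<comment> \<open>The column met by slot \<open>u\<close> in the chosen Leibniz terms. All
      values lie in \<open>A \<union> B\<close>, so two slots share a column.\<close>
    define k where "k u = (if u \<in> A - P then ?f A q u else ?f B q' (t u))" for u
    have t_in: "t u \<in> B" if "u \<in> U" "u \<notin> A - P" for u
    proof -
      have "u \<in> t ` B" using that U_split(1) t_im by auto
      then show ?thesis by (auto simp: tt)
    qed
    have "k ` U \<subseteq> A \<union> B"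
      using f_in[OF fin(1) q] f_in[OF fin(2) q'] t_in by (auto simp: k_def)
    then have "card (k ` U) \<le> card (A \<union> B)"
      using fin by (intro card_mono) auto
    also have "\<dots> < card U" using i fin by (simp add: U_def)
    finally have ninj: "\<not> inj_on k U" by (auto dest: card_image)
    have "(\<Prod>a\<in>A. Y (if a \<in> P then a else p a) (?f A q a)) *
        (\<Prod>b\<in>B. Y ((p \<circ> t) b) (?f B q' b)) =
        (\<Prod>a\<in>P. Y a (?f A q a)) * (\<Prod>u\<in>U. Y (p u) (k u))" for p
    proof -
      have "(\<Prod>a\<in>A. Y (if a \<in> P then a else p a) (?f A q a)) =
         (\<Prod>a\<in>A - P. Y (if a \<in> P then a else p a) (?f A q a)) *
         (\<Prod>a\<in>P. Y (if a \<in> P then a else p a) (?f A q a))"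
        using fin by (intro prod.subset_diff) (auto simp: P_def)
      also have "\<dots> = (\<Prod>a\<in>A - P. Y (p a) (k a)) * (\<Prod>a\<in>P. Y a (?f A q a))"
        by (intro arg_cong2[where f = "(*)"] prod.cong) (auto simp: k_def)
      finally have 1: "(\<Prod>a\<in>A. Y (if a \<in> P then a else p a) (?f A q a)) =
        (\<Prod>a\<in>A - P. Y (p a) (k a)) * (\<Prod>a\<in>P. Y a (?f A q a))" .
      have "(\<Prod>b\<in>B. Y ((p \<circ> t) b) (?f B q' b)) =
        (\<Prod>b\<in>B. (\<lambda>u. Y (p u) (?f B q' (t u))) (t b))"
        by (simp add: tt)
      also have "\<dots> = (\<Prod>u\<in>insert i (B - {i'}). Y (p u) (?f B q' (t u)))"
        using t_bij by (rule prod.reindex_bij_betw)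
      also have "\<dots> = (\<Prod>u\<in>insert i (B - {i'}). Y (p u) (k u))"
        using U_split(2) by (intro prod.cong) (auto simp: k_def)
      finally have 2: "(\<Prod>b\<in>B. Y ((p \<circ> t) b) (?f B q' b)) =
        (\<Prod>u\<in>insert i (B - {i'}). Y (p u) (k u))" .
      have "(\<Prod>u\<in>U. Y (p u) (k u)) =
        (\<Prod>a\<in>A - P. Y (p a) (k a)) * (\<Prod>u\<in>insert i (B - {i'}). Y (p u) (k u))"
        unfolding U_split(1) using fin U_split(2) by (intro prod.union_disjoint) auto
      then show ?thesis unfolding 1 2 by (simp add: mult_ac)
    qed
    then have "?L = (\<Sum>p | p permutes U. (\<Prod>a\<in>P. Y a (?f A q a)) *
        (of_int (sign p) * (\<Prod>u\<in>U. Y (p u) (k u))))"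
      by (simp add: mult_ac)
    also have "\<dots> = 0"
      using sum_sign_prod_eq_0[OF finU ninj tf] by (simp add: sum_distrib_left[symmetric])
    finally show ?thesis .
  qed
  define G where "G q q' p = signof q * signof q' * (of_int (sign p) *
       ((\<Prod>a\<in>A. Y (if a \<in> P then a else p a) (?f A q a)) *
        (\<Prod>b\<in>B. Y ((p \<circ> t) b) (?f B q' b))))" for q q' p
  have "(\<Sum>p | p permutes U. of_int (sign p) *
    (minor Y A (\<lambda>a. if a \<in> P then a else p a) * minor Y B (p \<circ> t))) =
    (\<Sum>p | p permutes U. \<Sum>q\<in>?QA. \<Sum>q'\<in>?QB. G q q' p)"
    unfolding minor_expand[OF fin(1)] minor_expand[OF fin(2)] sum_product G_def
    unfolding sum_distrib_left
    by (intro sum.cong refl) (simp only: mult_ac)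
  also have "\<dots> = (\<Sum>q\<in>?QA. \<Sum>p | p permutes U. \<Sum>q'\<in>?QB. G q q' p)"
    by (rule sum.swap)
  also have "\<dots> = (\<Sum>q\<in>?QA. \<Sum>q'\<in>?QB. \<Sum>p | p permutes U. G q q' p)"
    by (rule sum.cong[OF refl sum.swap])
  also have "\<dots> = 0"
    unfolding G_def sum_distrib_left[symmetric] using term0 by (intro sum.neutral ballI) simp
  finally show ?thesis .
qed

section \<open>Minors of the upper triangular matrix\<close>

text \<open>Passes from numbering from 0 to numbering from 1. The condition
  \<open>0 \<notin> S\<close> matters: truncated subtraction would identify 0 and 1.\<close>

lemma Suc_pick_image_pred:
  assumes fin: "finite S" and "0 \<notin> S" and k: "k < card S"
  shows "Suc (pick ((\<lambda>i. i - 1) ` S) k) = pick S k"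
proof -
  let ?S = "(\<lambda>i. i - 1) ` S" and ?s = "pick S k"
  have s: "?s \<in> S" using k by (rule pick_in_set_le)
  have pos: "x > 0" if "x \<in> S" for x using that assms(2) by (metis gr0I)
  have "{a \<in> ?S. a < ?s - 1} = (\<lambda>i. i - 1) ` {a \<in> S. a < ?s}"
    using pos by fastforce
  moreover have "inj_on (\<lambda>i. i - 1) {a \<in> S. a < ?s}"
    using pos by (auto simp: inj_on_def) (metis Suc_pred)
  ultimately have "card {a \<in> ?S. a < ?s - 1} = k"
    using card_pick_le[OF k] by (simp add: card_image)
  moreover have "?s - 1 \<in> ?S" using s by simp
  ultimately have "pick ?S k = ?s - 1" using pick_card_in_set[of "?s - 1" ?S] by simp
  then show ?thesis using pos[OF s] by simp
qed

text \<open>The matrix $Y$ numbered from 1 and without a size bound, so that \<open>minor\<close>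
  applies to it with no index shift.\<close>

definition entry :: "nat \<Rightarrow> nat \<Rightarrow> cpoly" where
  "entry r c = (if r \<le> c then indet r c else 0)"

text \<open>For sets of equal size, the order isomorphism from \<open>A\<close> to \<open>R\<close>.
  As row function it gives the minor with its rows in increasing order, hence without a
  sign.\<close>

definition increasing_map :: "nat set \<Rightarrow> nat set \<Rightarrow> nat \<Rightarrow> nat" where
  "increasing_map A R a = pick R (inv_into {0..<card A} (pick A) a)"

lemma bij_betw_increasing_map:
  assumes "finite A" "finite R" "card R = card A"
  shows "bij_betw (increasing_map A R) A R"
proof -
  have "bij_betw (pick R \<circ> inv_into {0..<card A} (pick A)) A R"
    using bij_betw_inv_into[OF bij_betw_pick[OF assms(1)]] bij_betw_pick[OF assms(2)] assms(3)
    by (auto intro: bij_betw_trans)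
  then show ?thesis by (simp add: increasing_map_def[abs_def] comp_def)
qed

lemma increasing_map_pick:
  assumes "finite A" "i < card A"
  shows "increasing_map A R (pick A i) = pick R i"
  using bij_betw_inv_into_left[OF bij_betw_pick[OF assms(1)]] assms(2)
  by (simp add: increasing_map_def)

lemma det_Ysub_eq_minor:
  assumes R: "R \<subseteq> {1..n}" and A: "A \<subseteq> {1..n}" and card_eq: "card R = card A"
  shows "det (Ysub n R A) = minor entry A (increasing_map A R)"
proof -
  let ?s = "\<lambda>S. (\<lambda>i. i - 1 :: nat) ` S"
  have fin: "finite R" "finite A" using R A finite_subset by blast+
  have 0: "0 \<notin> R" "0 \<notin> A" using R A by auto
  have dim: "card {i. i < n \<and> i \<in> ?s S} = card S" if "S \<subseteq> {1..n}" for S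
  proof -
    have "{i. i < n \<and> i \<in> ?s S} = ?s S" using that by fastforce
    moreover have "inj_on (\<lambda>i. i - 1) S"
      using that by (intro inj_on_diff_nat) auto
    ultimately show ?thesis by (simp add: card_image)
  qed
  have "Ysub n R A = mat (card A) (card A) (\<lambda>(i, j). entry (increasing_map A R (pick A i)) (pick A j))"
  proof (rule eq_matI)
    fix i j
    assume "i < dim_row (mat (card A) (card A) (\<lambda>(i, j). entry (increasing_map A R (pick A i)) (pick A j)))"
      and "j < dim_col (mat (card A) (card A) (\<lambda>(i, j). entry (increasing_map A R (pick A i)) (pick A j)))"
    then have i: "i < card R" "i < card A" and j: "j < card A" using card_eq by auto
    have pi: "Suc (pick (?s R) i) = pick R i" and pj: "Suc (pick (?s A) j) = pick A j"
      using fin 0 i j Suc_pick_image_pred by auto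
    have "pick R i \<in> R" "pick A j \<in> A" using i j pick_in_set_le by auto
    then have lt: "pick (?s R) i < n" "pick (?s A) j < n"
      using R A unfolding pi[symmetric] pj[symmetric] by auto
    have "Ysub n R A $$ (i, j) = Ymat n $$ (pick (?s R) i, pick (?s A) j)"
      unfolding Ysub_def using i j dim[OF R] dim[OF A]
      by (intro submatrix_index) (simp_all add: Ymat_def)
    also have "\<dots> = entry (pick R i) (pick A j)"
      unfolding pi[symmetric] pj[symmetric] using lt by (simp add: Ymat_def entry_def)
    finally show "Ysub n R A $$ (i, j) = mat (card A) (card A)
        (\<lambda>(i, j). entry (increasing_map A R (pick A i)) (pick A j)) $$ (i, j)"
      using i j fin by (simp add: increasing_map_pick)
  qed (use dim[OF R] dim[OF A] card_eq in \<open>simp_all add: Ysub_def dim_submatrix Ymat_def\<close>)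
  then show ?thesis by (simp add: minor_def)
qed

text \<open>Sorting the rows costs a sign. Only its being 1 or -1 matters later.\<close>

lemma minor_eq_det_Ysub:
  assumes A: "A \<subseteq> {1..n}" and rA: "r ` A \<subseteq> {1..n}" and inj: "inj_on r A"
  shows "\<exists>d\<in>{1, -1 :: int}. minor entry A r = of_int d * det (Ysub n (r ` A) A)"
proof -
  have fin: "finite A" using A finite_subset by blast
  have card_eq: "card (r ` A) = card A" using inj by (rule card_image)
  have "bij_betw (increasing_map A (r ` A)) A (r ` A)"
    using fin card_eq by (intro bij_betw_increasing_map) auto
  then show ?thesis
    unfolding det_Ysub_eq_minor[OF rA A card_eq]
    using fin inj by (intro minor_same_image) (auto simp: bij_betw_def)
qed

text \<open>Some Leibniz term is nonzero, so all its entries lie on or above the diagonal. Its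
  permutation matches each row with a column at least as large, and \<open>set_leI\<close>
  applies.\<close>

lemma set_le_if_det_Ysub_nonzero:
  assumes R: "R \<subseteq> {1..n}" and A: "A \<subseteq> {1..n}" and card_eq: "card R = card A"
    and nz: "det (Ysub n R A) \<noteq> 0"
  shows "set_le R A"
proof -
  let ?I = "{0..<card A}"
  let ?k = "\<lambda>p a. pick A (p (inv_into ?I (pick A) a))"
  have fin: "finite R" "finite A" using R A finite_subset by blast+
  have "(\<Sum>p | p permutes ?I. signof p * (\<Prod>a\<in>A. entry (increasing_map A R a) (?k p a))) \<noteq> 0"
    using nz unfolding det_Ysub_eq_minor[OF R A card_eq] minor_expand[OF fin(2)] .
  then obtain p where p: "p permutes ?I"
    and "signof p * (\<Prod>a\<in>A. entry (increasing_map A R a) (?k p a)) \<noteq> 0"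
    by (metis (no_types, lifting) mem_Collect_eq sum.neutral)
  then have "(\<Prod>a\<in>A. entry (increasing_map A R a) (?k p a)) \<noteq> 0" by auto
  then have "entry (increasing_map A R a) (?k p a) \<noteq> 0" if "a \<in> A" for a
    using that fin(2) by (metis prod_zero)
  then have le: "increasing_map A R a \<le> ?k p a" if "a \<in> A" for a
    using that by (metis entry_def)
  have "bij_betw (pick A \<circ> (p \<circ> inv_into ?I (pick A))) A A"
    using bij_betw_pick[OF fin(2)] permutes_imp_bij[OF p]
    by (intro bij_betw_trans) (auto intro: bij_betw_inv_into)
  then have "bij_betw (?k p) A A" by (simp add: comp_def)
  with fin card_eq le show ?thesis
    by (intro set_leI[OF _ bij_betw_increasing_map]) auto
qed

section \<open>From a signed relation to linear dependence\<close>

lemma cpoly_eq_neg_self: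
  fixes x :: cpoly
  assumes "x = - x"
  shows "x = 0"
proof (rule poly_mapping_eqI)
  fix k
  have "Poly_Mapping.lookup x k = - Poly_Mapping.lookup x k" using arg_cong[OF assms, of "\<lambda>x. Poly_Mapping.lookup x k"] by simp
  then show "Poly_Mapping.lookup x k = Poly_Mapping.lookup 0 k" by simp
qed

lemma scale_add_left: "scale (a + b) p = scale a p + scale b p"
  by (simp add: scale_def single_add distrib_right)

lemma scale_sum_left: "scale (sum c A) p = (\<Sum>a\<in>A. scale (c a) p)"
proof (induction A rule: infinite_finite_induct)
  case (insert a A)
  then show ?case by (simp add: scale_add_left)
qed (simp_all add: scale_def)

lemma scale_sign: "d \<in> {1, -1} \<Longrightarrow> scale (of_int d) p = of_int d * p"
  by (auto simp: scale_def single_uminus)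

text \<open>Terms with the same index are collected. In the fibre of \<open>C s0\<close> all signs
  agree, so its coefficient is plus or minus the fibre size, nonzero over the complex numbers.
  Vanishing terms are exempt, as their index may lie outside \<open>I\<close>.\<close>

lemma lin_dependent_familyI:
  fixes w :: "'s \<Rightarrow> cpoly" and C :: "'s \<Rightarrow> 'i"
  assumes fin: "finite S" and sum0: "sum w S = 0"
    and s0: "s0 \<in> S" "C s0 \<in> I" "\<exists>d\<in>{1, -1 :: int}. w s0 = of_int d * F (C s0)"
    and C: "\<And>s. s \<in> S \<Longrightarrow> w s \<noteq> 0 \<Longrightarrow> C s \<in> I"
    and sgn: "\<And>s. s \<in> S \<Longrightarrow> w s \<noteq> 0 \<Longrightarrow> \<exists>d\<in>{1, -1 :: int}. w s = of_int d * F (C s)"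
    and fibre: "\<And>s. s \<in> S \<Longrightarrow> w s \<noteq> 0 \<Longrightarrow> C s = C s0 \<Longrightarrow> w s = w s0"
  shows "lin_dependent_family F I"
\<comment> \<open>A zero member is dependent by itself. Otherwise \<open>w s0\<close> is nonzero and
  belongs to the fibre counted below.\<close>
proof (cases "F (C s0) = 0")
  case True
  then have "(\<Sum>i\<in>{C s0}. scale 1 (F i)) = 0" by (simp add: scale_def)
  then show ?thesis
    unfolding lin_dependent_family_def using s0(2)
    by (intro exI[of _ "{C s0}"] exI[of _ "\<lambda>_. 1"]) auto
next
  case False
  let ?G = "{s\<in>S. w s \<noteq> 0}"
  have s0G: "s0 \<in> ?G" using s0 False by auto
  have "\<forall>s\<in>?G. \<exists>d. d \<in> {1, -1 :: int} \<and> w s = of_int d * F (C s)"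
    using sgn by blast
  from bchoice[OF this] obtain d :: "'s \<Rightarrow> int"
    where "\<forall>s\<in>?G. d s \<in> {1, -1} \<and> w s = of_int (d s) * F (C s)" ..
  then have d: "d s \<in> {1, -1}" "w s = of_int (d s) * F (C s)" if "s \<in> ?G" for s
    using that by (simp_all del: insert_iff)
  define c where "c i = (\<Sum>s | s \<in> ?G \<and> C s = i. of_int (d s) :: complex)" for i
  have "(\<Sum>i\<in>C ` ?G. scale (c i) (F i)) = (\<Sum>i\<in>C ` ?G. \<Sum>s | s \<in> ?G \<and> C s = i. w s)"
    unfolding c_def scale_sum_left
  proof (intro sum.cong refl)
    fix i s assume "s \<in> {s. s \<in> ?G \<and> C s = i}"
    then have s: "s \<in> ?G" "C s = i" by simp_all
    show "scale (of_int (d s)) (F i) = w s"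
      using scale_sign[OF d(1)[OF s(1)], of "F i"] d(2)[OF s(1)] s(2) by simp
  qed
  also have "\<dots> = sum w ?G"
    using fin by (intro sum.image_gen[symmetric]) simp
  also have "\<dots> = sum w S"
    using fin by (intro sum.mono_neutral_left) auto
  finally have rel: "(\<Sum>i\<in>C ` ?G. scale (c i) (F i)) = 0" using sum0 by simp
  \<comment> \<open>Equal terms with opposite signs would give \<open>w s0 = - w s0\<close>, hence
    \<open>w s0 = 0\<close>.\<close>
  have "d s = d s0" if s: "s \<in> ?G" "C s = C s0" for s
  proof (rule ccontr)
    assume "d s \<noteq> d s0"
    then have "d s = - d s0" using d(1)[OF s(1)] d(1)[OF s0G] by auto
    moreover have "w s = w s0" using fibre s by auto
    ultimately have "w s0 = - w s0" using d(2)[OF s(1)] d(2)[OF s0G] s(2) by simp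
    then show False using cpoly_eq_neg_self s0G by blast
  qed
  then have "c (C s0) = of_nat (card {s. s \<in> ?G \<and> C s = C s0}) * of_int (d s0)"
    by (simp add: c_def)
  moreover have "card {s. s \<in> ?G \<and> C s = C s0} > 0"
    using fin s0G by (subst card_gt_0_iff) auto
  moreover have "d s0 \<noteq> 0" using d(1)[OF s0G] by auto
  ultimately have "c (C s0) \<noteq> 0" by simp
  then show ?thesis
    unfolding lin_dependent_family_def using fin C s0G rel
    by (intro exI[of _ "C ` ?G"] exI[of _ c]) auto
qed

section \<open>Terms sharing the rows of the identity term\<close>

text \<open>
  A permutation of \<open>U\<close> that preserves the row sets of both minors splits into a permutation of
  the rows of each, so its sign is cancelled by the signs of the two minors.
\<close>

lemma garnir_term_eq:
  fixes Y :: "nat \<Rightarrow> nat \<Rightarrow> 'a :: comm_ring_1"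
  assumes fin: "finite A" "finite B"
    and i: "i \<notin> A" "i \<notin> B" "i' \<in> A" "i' \<in> B"
    and p: "p permutes insert i (A \<union> B)"
  defines "P \<equiv> A \<inter> B - {i'}" and "t \<equiv> Transposition.transpose i i'"
  assumes im: "(p \<circ> t) ` B = t ` B"
  shows "of_int (sign p) * (minor Y A (\<lambda>a. if a \<in> P then a else p a) * minor Y B (p \<circ> t)) =
    minor Y A id * minor Y B t"
proof -
  let ?U = "insert i (A \<union> B)"
  have tt: "t \<circ> t = id" by (simp add: t_def)
  have t_im: "t ` B = insert i (B - {i'})"
    using i by (auto simp: t_def Transposition.transpose_def image_iff)
  have U: "?U - t ` B = A - P" using i by (auto simp: t_im P_def)
  have pB: "p ` (t ` B) = t ` B" using im by (simp add: image_comp)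
  have injp: "inj p" using p by (rule permutes_inj)
  \<comment> \<open>\<open>p\<close> preserves \<open>U\<close> and the rows of the second minor,
    hence also their complement.\<close>
  have pA: "p ` (A - P) = A - P"
    unfolding U[symmetric] using image_set_diff[OF injp] permutes_image[OF p] pB by simp
  \<comment> \<open>The restrictions of \<open>p\<close> to the two blocks, extended by the
    identity, so that \<open>p = p1 \<circ> p2\<close>.\<close>
  define p1 where "p1 x = (if x \<in> A - P then p x else x)" for x
  define p2 where "p2 x = (if x \<in> t ` B then p x else x)" for x
  have inj_S: "inj_on p S" for S using injp by (rule inj_on_subset) simp
  have "bij_betw p1 (A - P) (A - P)"
    by (subst bij_betw_cong[where g = p]) (auto simp: p1_def bij_betw_def inj_S pA)
  then have p1': "p1 permutes A - P" by (rule bij_imp_permutes) (auto simp: p1_def)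
  then have p1: "p1 permutes A" by (rule permutes_subset) auto
  have "bij_betw p2 (t ` B) (t ` B)"
    by (subst bij_betw_cong[where g = p]) (auto simp: p2_def bij_betw_def inj_S pB)
  then have p2: "p2 permutes t ` B" by (rule bij_imp_permutes) (simp add: p2_def)
  have perm: "permutation p1" "permutation p2" "permutation t"
    using p1 p2 fin permutation_permutes by (blast, blast, simp add: t_def permutation_swap_id)
  have "p = p1 \<circ> p2"
  proof
    fix x
    consider "x \<in> t ` B" | "x \<in> A - P" "x \<notin> t ` B" | "x \<notin> ?U" using U by blast
    then show "p x = (p1 \<circ> p2) x"
    proof cases
      case 1
      then have "p x \<in> t ` B" using pB by blast
      then have "p x \<notin> A - P" using U by blast
      with 1 show ?thesis by (auto simp: p1_def p2_def)
    next
      case 3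
      then have "x \<notin> A - P" "x \<notin> t ` B" unfolding t_im using i by auto
      then show ?thesis using permutes_not_in[OF p 3] by (simp add: p1_def p2_def)
    qed (simp add: p1_def p2_def)
  qed
  then have sgn: "sign p = sign p1 * sign p2" using perm by (simp add: sign_compose)
  have "minor Y A (\<lambda>a. if a \<in> P then a else p a) = minor Y A (id \<circ> p1)"
    by (intro minor_cong) (auto simp: p1_def)
  then have 1: "minor Y A (\<lambda>a. if a \<in> P then a else p a) = of_int (sign p1) * minor Y A id"
    using fin p1 by (simp only: minor_compose_permutation)
  \<comment> \<open>The conjugate of \<open>p2\<close> by \<open>t\<close> acts on the slots
    \<open>B\<close> instead of the labels; it has the sign of \<open>p2\<close>, and
    \<open>t \<circ> ?q = p2 \<circ> t\<close>.\<close>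
  let ?q = "t \<circ> p2 \<circ> t"
  have "bij_betw t B (t ` B)" by (simp add: t_def bij_betw_def)
  moreover have "bij_betw t (t ` B) B"
    by (simp add: t_def bij_betw_def image_comp)
  ultimately have "bij_betw ?q B B"
    using permutes_imp_bij[OF p2] by (blast intro: bij_betw_trans)
  moreover have "?q x = x" if "x \<notin> B" for x
  proof -
    have "t x \<notin> t ` B" using that by (auto simp: t_def inj_image_mem_iff)
    then show ?thesis by (simp add: p2_def t_def)
  qed
  ultimately have q: "?q permutes B" by (rule bij_imp_permutes)
  have "minor Y B (p \<circ> t) = minor Y B (t \<circ> ?q)"
    by (intro minor_cong) (simp add: p2_def t_def)
  then have "minor Y B (p \<circ> t) = of_int (sign ?q) * minor Y B t"
    using fin q by (simp only: minor_compose_permutation)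
  also have "sign ?q = sign p2"
  proof -
    have "sign ?q = sign t * sign p2 * sign t"
      using perm by (simp add: sign_compose permutation_compose)
    then show ?thesis by (simp add: mult_ac)
  qed
  finally have 2: "minor Y B (p \<circ> t) = of_int (sign p2) * minor Y B t" .
  have "of_int (sign p1 * sign p2) * (of_int (sign p1) * x * (of_int (sign p2) * y)) = x * y"
    for x y :: 'a
    by (cases p1 rule: sign_cases; cases p2 rule: sign_cases) simp_all
  then show ?thesis unfolding 1 2 sgn .
qed

section \<open>Dependence obtained from two columns of the diagram\<close>

theorem theorem3p1:
  fixes n :: nat and D :: "(nat \<times> nat) set"
  assumes "diagram n D"
    and "\<exists>i1 i2 j1 j2. 1 \<le> i1 \<and> i1 < i2 \<and> i2 \<le> n \<and> 1 \<le> j1 \<and> j1 < j2 \<and> j2 \<le> n \<and>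
           (i1, j1) \<notin> D \<and> (i1, j2) \<notin> D \<and> (i2, j1) \<in> D \<and> (i2, j2) \<in> D"
  shows "lin_dependent_family (det_poly n D) {C. diagram n C \<and> diagram_le n C D}"
proof -
  from assms(2) obtain i1 i2 j1 j2 where i: "1 \<le> i1" "i1 < i2" "i2 \<le> n"
    and j: "1 \<le> j1" "j1 < j2" "j2 \<le> n"
    and D: "(i1, j1) \<notin> D" "(i1, j2) \<notin> D" "(i2, j1) \<in> D" "(i2, j2) \<in> D"
    by blast
  define A where "A = column D j1"
  define B where "B = column D j2"
  define P where "P = A \<inter> B - {i2}"
  define U where "U = insert i1 (A \<union> B)"
  \<comment> \<open>On \<open>B\<close>, \<open>t\<close> moves only \<open>i2\<close>, replacing it
    by \<open>i1\<close>; at \<open>p = id\<close> this yields the starting rows of the second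
    minor.\<close>
  define t where "t = Transposition.transpose i1 i2"
  have iAB: "i1 \<notin> A" "i1 \<notin> B" "i2 \<in> A" "i2 \<in> B"
    using D by (auto simp: A_def B_def column_def)
  have A: "A \<subseteq> {1..n}" and B: "B \<subseteq> {1..n}"
    using assms(1) by (auto simp: A_def B_def column_def diagram_def)
  then have U: "U \<subseteq> {1..n}" using i by (auto simp: U_def)
  have fin: "finite A" "finite B" "finite U" using A B U finite_subset by blast+
  define rA where "rA p a = (if a \<in> P then a else p a)" for p :: "nat \<Rightarrow> nat" and a
  \<comment> \<open>The diagram whose columns \<open>j1\<close> and \<open>j2\<close> are the row
    sets of the term of \<open>p\<close>. If \<open>rA p\<close> repeats a row, column
    \<open>j1\<close> loses boxes, but then \<open>w p = 0\<close>.\<close>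
  define C where "C p = {(x, y). if y = j1 then x \<in> rA p ` A
      else if y = j2 then x \<in> (p \<circ> t) ` B else (x, y) \<in> D}" for p
  \<comment> \<open>The common factor from the columns left unchanged; multiplying the relation by
    it turns products of two minors into values of \<open>det_poly n D\<close>, up to sign.\<close>
  define h where "h = (\<Prod>j\<in>{1..n} - {j1, j2}. det (Ysub n (column D j) (column D j)))"
  define w where "w p = of_int (sign p) * (minor entry A (rA p) * minor entry B (p \<circ> t)) * h" for p
  let ?S = "{p. p permutes U}" and ?I = "{C. diagram n C \<and> diagram_le n C D}"
  have col: "column (C p) j1 = rA p ` A" "column (C p) j2 = (p \<circ> t) ` B"
    "y \<noteq> j1 \<Longrightarrow> y \<noteq> j2 \<Longrightarrow> column (C p) y = column D y" for p y
    using j by (auto simp: column_def C_def)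
  have det_C: "det_poly n D (C p) =
    det (Ysub n (rA p ` A) A) * (det (Ysub n ((p \<circ> t) ` B) B) * h)" for p
  proof -
    have J: "{1..n} = insert j1 (insert j2 ({1..n} - {j1, j2}))" using j by auto
    show ?thesis
      unfolding det_poly_def by (subst J) (use j in \<open>simp add: col A_def B_def h_def\<close>)
  qed
  have sum0: "sum w ?S = 0"
    unfolding w_def rA_def sum_distrib_right[symmetric] U_def P_def t_def
    using garnir_relation[OF fin(1,2) iAB cpoly_eq_neg_self, of entry] by simp
  have tB: "t ` B \<subseteq> U"
    using iAB by (auto simp: t_def Transposition.transpose_def U_def)
  have rows: "rA p ` A \<subseteq> {1..n}" "(p \<circ> t) ` B \<subseteq> {1..n}" "inj_on (p \<circ> t) B"
    if "p permutes U" for p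
  proof -
    have pU: "p x \<in> {1..n}" if "x \<in> U" for x
      using U permutes_in_image[OF \<open>p permutes U\<close>] that by blast
    show "rA p ` A \<subseteq> {1..n}" using A pU by (auto simp: rA_def U_def)
    show "(p \<circ> t) ` B \<subseteq> {1..n}" using pU tB by auto
    have "inj (p \<circ> t)" using permutes_inj[OF that] by (simp add: inj_compose t_def)
    then show "inj_on (p \<circ> t) B" by (rule inj_on_subset) simp
  qed
  have C_in: "C p \<in> ?I"
    if "p permutes U" and "set_le (rA p ` A) A" "set_le ((p \<circ> t) ` B) B" for p
  proof -
    have "diagram n (C p)"
      unfolding diagram_def
    proof (rule subrelI)
      fix x y assume "(x, y) \<in> C p"
      then consider "y = j1" "x \<in> rA p ` A" | "y = j2" "x \<in> (p \<circ> t) ` B" | "(x, y) \<in> D"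
        by (simp only: C_def mem_Collect_eq case_prod_conv split: if_splits)
      then show "(x, y) \<in> {1..n} \<times> {1..n}"
        using rows(1,2)[OF that(1)] assms(1) j by cases (unfold diagram_def, auto)
    qed
    moreover have "set_le (column (C p) y) (column D y)" for y
      using that(2,3) col(1,2)[of p] col(3)[of y p]
      by (cases "y = j1"; cases "y = j2") (auto simp: A_def B_def set_le_refl)
    ultimately show ?thesis by (simp add: diagram_le_def)
  qed
  have w_sgn: "\<exists>d\<in>{1, -1 :: int}. w p = of_int d * det_poly n D (C p)"
    if p: "p permutes U" and inj: "inj_on (rA p) A" for p
  proof -
    obtain d d' :: int where d: "d \<in> {1, -1}" "d' \<in> {1, -1}"
      and "minor entry A (rA p) = of_int d * det (Ysub n (rA p ` A) A)"
      and "minor entry B (p \<circ> t) = of_int d' * det (Ysub n ((p \<circ> t) ` B) B)"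
      using minor_eq_det_Ysub[OF A rows(1)[OF p] inj]
        minor_eq_det_Ysub[OF B rows(2)[OF p] rows(3)[OF p]] by blast
    then have "w p = of_int (sign p * d * d') * det_poly n D (C p)"
      by (simp add: w_def det_C mult_ac)
    moreover have "sign p * d * d' \<in> {1, -1}"
      using d by (cases p rule: sign_cases) auto
    ultimately show ?thesis by blast
  qed
  have w_inj: "inj_on (rA p) A" if "w p \<noteq> 0" for p
  proof (rule ccontr)
    assume "\<not> inj_on (rA p) A"
    then have "minor entry A (rA p) = 0" using fin by (intro minor_eq_0_if_not_inj)
    then show False using that by (simp add: w_def)
  qed
  have rA_id: "rA id = id" by (auto simp: rA_def)
  have S: "finite ?S" using fin by (simp add: finite_permutations)
  have C_id: "C id \<in> ?I"
  proof (rule C_in)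
    \<comment> \<open>Match \<open>t b\<close> with \<open>b\<close>: since \<open>i1 < i2\<close>,
      no row increases.\<close>
    show "set_le ((id \<circ> t) ` B) B"
      by (rule set_leI[where f = t and g = id and I = B])
        (use fin i iAB in \<open>auto simp: bij_betw_def t_def Transposition.transpose_def\<close>)
  qed (simp_all add: rA_id set_le_refl permutes_id)
  have w_id: "\<exists>d\<in>{1, -1 :: int}. w id = of_int d * det_poly n D (C id)"
    by (rule w_sgn) (simp_all add: rA_id permutes_id)
  show ?thesis
  proof (rule lin_dependent_familyI[where C = C and F = "det_poly n D", OF S sum0 _ C_id w_id])
    fix p assume "p \<in> ?S" and w: "w p \<noteq> 0"
    then have p: "p permutes U" by simp
    have inj: "inj_on (rA p) A" using w by (rule w_inj)
    show "\<exists>d\<in>{1, -1 :: int}. w p = of_int d * det_poly n D (C p)"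
      using p inj by (rule w_sgn)
    \<comment> \<open>A nonzero term has two nonzero minors, and triangularity then gives both
      comparisons needed for \<open>C p \<le> D\<close>.\<close>
    then have "det_poly n D (C p) \<noteq> 0" using w by auto
    then have nz: "det (Ysub n (rA p ` A) A) \<noteq> 0" "det (Ysub n ((p \<circ> t) ` B) B) \<noteq> 0"
      by (auto simp: det_C)
    show "C p \<in> ?I"
      by (intro C_in[OF p]
          set_le_if_det_Ysub_nonzero[OF rows(1)[OF p] A card_image[OF inj] nz(1)]
          set_le_if_det_Ysub_nonzero[OF rows(2)[OF p] B card_image[OF rows(3)[OF p]] nz(2)])
    assume "C p = C id"
    \<comment> \<open>Column \<open>j2\<close> shows that \<open>p\<close> preserves the starting
      rows of the second minor, so its term equals the identity term with sign included.\<close>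
    then have "(p \<circ> t) ` B = t ` B" using col(2)[of p] col(2)[of id] by simp
    then have "of_int (sign p) * (minor entry A (rA p) * minor entry B (p \<circ> t)) =
      minor entry A id * minor entry B t"
      unfolding rA_def P_def t_def using p
      by (intro garnir_term_eq[OF fin(1,2) iAB]) (simp_all add: U_def)
    then show "w p = w id" by (simp add: w_def rA_id)
  qed (simp only: mem_Collect_eq permutes_id)
qed

end
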